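(* Let $\alpha$ be an irrational real number and let $T$ be the transformation of the 2-torus $\mathbb{T}^2=(\mathbb{R}/\mathbb{Z})^2$, equipped with its Haar probability measure, defined by \[T(s,t)=(s+\alpha,\ 2s+t+\alpha)\pmod 1.\] Then the (zero entropy) transformation $T$ does not have property AT$(n)$ for any positive integer $n$.
   Context: AT$(n)$: Let $T$ be a measure preserving automorphism (invertible measure preserving transformation) of a standard probability space $(X,\mathfrak{B},\mu)$, and let $L^1_+(X,\mu)$ be the set of nonnegative functions in $L^1(X,\mu)$. For an integer $n\ge 1$, the system $(X,\mathfrak{B},\mu,T)$ (or simply $T$) is AT$(n)$ if for every $\varepsilon>0$ and every finite set of functions $f_1,\ldots,f_r\in L^1_+(X,\mu)$ there exist $n$ functions $g_1,\ldots,g_n\in L^1_+(X,\mu)$, a positive integer $N$, nonnegative reals $\alpha_{i,j}^{(m)}$ ($1\le m\le n$, $1\le i\le r$, $1\le j\le N$) and integers $t_j^{(m)}$ ($1\le m\le n$, $1\le j\le N$) such that \[\Big\|f_{i}-\sum_{m=1}^{n}\sum_{j=1}^{N}\alpha_{i,j}^{(m)}\,g_{m}\circ T^{t_{j}^{(m)}}\Big\|_{1}<\varepsilon\quad\text{for } i=1,\ldots,r.\] That the transformation $T$ of the torus is measure preserving, uniquely ergodic and has zero entropy is a known fact (due to Furstenberg) and is not part of the assertion; the assertion is that $T$ is not AT$(n)$ for any $n\ge1$. *)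

theory Defs
  imports "HOL-Analysis.Analysis"
begin

text \<open>Integer powers of an invertible self-map of \<open>X\<close>; the inverse is taken on \<open>X\<close> only,
  so the definition is meaningful for \<open>T\<close> with \<open>bij_betw T X X\<close>.\<close>

definition int_iter :: "'a set \<Rightarrow> ('a \<Rightarrow> 'a) \<Rightarrow> int \<Rightarrow> 'a \<Rightarrow> 'a" where
  "int_iter X T k =
     (if 0 \<le> k then T ^^ nat k else (inv_into X T) ^^ nat (- k))"

definition L1_nonneg :: "'a measure \<Rightarrow> ('a \<Rightarrow> real) set" where
  "L1_nonneg M = {f. integrable M f \<and> (AE x in M. 0 \<le> f x)}"

definition L1_norm :: "'a measure \<Rightarrow> ('a \<Rightarrow> real) \<Rightarrow> real" where
  "L1_norm M f = (LINT x|M. \<bar>f x\<bar>)"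

text \<open>The property AT(n) of a measure preserving automorphism \<open>T\<close> of a standard probability
  space \<open>M\<close>. These standing assumptions on \<open>M\<close> and \<open>T\<close> are not part of the definition;
  they make every function inside \<^const>\<open>L1_norm\<close> below integrable.\<close>

definition AT :: "'a measure \<Rightarrow> ('a \<Rightarrow> 'a) \<Rightarrow> nat \<Rightarrow> bool" where
  "AT M T n \<longleftrightarrow>
     (\<forall>\<epsilon>>0. \<forall>(r::nat) (f :: nat \<Rightarrow> 'a \<Rightarrow> real).
        (\<forall>i\<in>{1..r}. f i \<in> L1_nonneg M) \<longrightarrow>
        (\<exists>(g :: nat \<Rightarrow> 'a \<Rightarrow> real) (N::nat)
            (a :: nat \<Rightarrow> nat \<Rightarrow> nat \<Rightarrow> real) (t :: nat \<Rightarrow> nat \<Rightarrow> int).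
           (\<forall>m\<in>{1..n}. g m \<in> L1_nonneg M) \<and>
           N \<ge> 1 \<and>
           (\<forall>m\<in>{1..n}. \<forall>i\<in>{1..r}. \<forall>j\<in>{1..N}. 0 \<le> a m i j) \<and>
           (\<forall>i\<in>{1..r}.
              L1_norm M (\<lambda>x. f i x -
                (\<Sum>m=1..n. \<Sum>j=1..N. a m i j * g m (int_iter (space M) T (t m j) x))) < \<epsilon>)))"

text \<open>The 2-torus is represented by the fundamental domain \<open>[0,1)\<^sup>2\<close> of \<open>\<real>\<^sup>2\<close> modulo \<open>\<int>\<^sup>2\<close>; its
  Haar probability measure is then Lebesgue measure, and reduction modulo 1 is \<^const>\<open>frac\<close>.\<close>

definition torus2 :: "(real \<times> real) measure" where
  "torus2 = restrict_space lborel ({0..<1} \<times> {0..<1})"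

definition torus_skew :: "real \<Rightarrow> real \<times> real \<Rightarrow> real \<times> real" where
  "torus_skew \<alpha> = (\<lambda>(s, t). (frac (s + \<alpha>), frac (2 * s + t + \<alpha>)))"

end

theory Submission imports Defs "HOL-Probability.Probability" begin

text \<open>Cut the torus into \<open>q\<close> strips \<open>A\<^sub>i\<close> according to the second coordinate. Under distinct powers of
  \<open>T\<close> these partitions are pairwise independent. If the indicators of the strips were approximated by
  the functions \<open>\<Sum>\<^sub>k a\<^sub>i(k) g\<^sub>m \<circ> T\<^sup>k\<close>, then each \<open>g\<^sub>m\<close> would live on points \<open>y\<close> where the weighted number
  \<open>\<Phi>(y) = \<Sum>\<^sub>k \<Sum>\<^sub>i a\<^sub>i(k) 1\<^sub>A\<^sub>i(T\<^bsup>-k\<^esup> y)\<close> of hits is close to its maximum, whereas its mean is only \<open>1/q\<close> of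
  the maximum. Pairwise independence bounds the variance of \<open>\<Phi>\<close>, and since
  \<open>h = \<Sum>\<^sub>k \<Sum>\<^sub>i a\<^sub>i(k) g\<^sub>m \<circ> T\<^sup>k\<close> is essentially bounded, \<open>g\<^sub>m\<close> cannot concentrate: it accounts for a mass of
  order \<open>q\<^bsup>-1/2\<^esup>\<close> only. So \<open>n\<close> such functions do not suffice once \<open>\<surd>q\<close> is large compared with \<open>n\<close>.\<close>

section \<open>Pairwise independent partitions and approximate transitivity\<close>

text \<open>Negative times are part of the data, so no inverse map has to be formed. The group laws
  are asked only on \<open>space M\<close>, because formulas built with \<open>frac\<close> invert
  each other only on the fundamental domain.\<close>

locale measure_preserving_flow = prob_space M for M :: "'a measure" +
  fixes \<tau> :: "int \<Rightarrow> 'a \<Rightarrow> 'a"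
  assumes flow_measurable [measurable]: "\<tau> k \<in> M \<rightarrow>\<^sub>M M"
    and distr_flow: "distr M M (\<tau> k) = M"
    and flow_add: "x \<in> space M \<Longrightarrow> \<tau> j (\<tau> k x) = \<tau> (j + k) x"
    and flow_0: "x \<in> space M \<Longrightarrow> \<tau> 0 x = x"
begin

lemma flow_space: "x \<in> space M \<Longrightarrow> \<tau> k x \<in> space M"
  using flow_measurable by (rule measurable_space)

lemma flow_inverse: "x \<in> space M \<Longrightarrow> \<tau> (- k) (\<tau> k x) = x" "x \<in> space M \<Longrightarrow> \<tau> k (\<tau> (- k) x) = x"
  by (simp_all add: flow_add flow_0)

lemma integral_flow:
  fixes f :: "'a \<Rightarrow> real"
  assumes [measurable]: "f \<in> borel_measurable M"
  shows "(LINT x|M. f (\<tau> k x)) = (LINT x|M. f x)"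
  using integral_distr[OF flow_measurable assms, of k] by (simp add: distr_flow)

lemma integrable_flow:
  fixes f :: "'a \<Rightarrow> real"
  assumes "integrable M f"
  shows "integrable M (\<lambda>x. f (\<tau> k x))"
  using integrable_distr[OF flow_measurable, of k f] assms by (simp add: distr_flow)

lemma AE_flow:
  assumes "AE x in M. P x"
  shows "AE x in M. P (\<tau> k x)"
proof -
  have "AE x in distr M M (\<tau> k). P x"
    unfolding distr_flow by (rule assms)
  then show ?thesis
    by (rule AE_distrD[OF flow_measurable])
qed

text \<open>Substitute y = \<tau> k x. This moves the shift from \<open>g\<close> to the test
  function, so that a sum over many shifts of \<open>g\<close> becomes one integral against
  \<open>g\<close> itself.\<close>

lemma integral_mult_flow:
  fixes u g :: "'a \<Rightarrow> real"
  assumes [measurable]: "u \<in> borel_measurable M" "g \<in> borel_measurable M"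
  shows "(LINT x|M. u x * g (\<tau> k x)) = (LINT y|M. u (\<tau> (- k) y) * g y)"
proof -
  have "(LINT x|M. u x * g (\<tau> k x)) = (LINT x|M. u (\<tau> (- k) (\<tau> k x)) * g (\<tau> k x))"
    by (rule Bochner_Integration.integral_cong) (simp_all add: flow_inverse)
  also have "\<dots> = (LINT y|M. u (\<tau> (- k) y) * g y)"
    by (rule integral_flow[of "\<lambda>y. u (\<tau> (- k) y) * g y"]) measurable
  finally show ?thesis .
qed

end

text \<open>\<open>q\<close> is a square so that the square root of \<open>q\<close>, which enters
  through the variance, is the natural number \<open>Q\<close>. Independence for positive times
  suffices: of two distinct times, the smaller can be shifted to 0.\<close>

locale uniform_independent_partition = measure_preserving_flow M \<tau> for M :: "'a measure" and \<tau> +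
  fixes Q q :: nat and A :: "nat \<Rightarrow> 'a set"
  assumes Q_pos: "0 < Q" and q_eq: "q = Q\<^sup>2"
    and A_sets [measurable]: "i \<in> {1..q} \<Longrightarrow> A i \<in> sets M"
    and A_partition: "x \<in> space M \<Longrightarrow> (\<Sum>i=1..q. indicator (A i) x) = (1::real)"
    and prob_A: "i \<in> {1..q} \<Longrightarrow> prob (A i) = 1 / q"
    and prob_A_flow: "\<lbrakk>0 < k; i \<in> {1..q}; j \<in> {1..q}\<rbrakk> \<Longrightarrow>
        prob {x \<in> space M. \<tau> k x \<in> A i \<and> x \<in> A j} = 1 / (real q)\<^sup>2"
begin

section \<open>Orthogonality of the shifted strips and second moments\<close>

lemma q_pos: "0 < q"
  using Q_pos q_eq by simp

lemma indicator_A_measurable [measurable]: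
  "i \<in> {1..q} \<Longrightarrow> (indicator (A i) :: 'a \<Rightarrow> real) \<in> borel_measurable M"
  by (simp add: borel_measurable_indicator)

lemma integrable_indicator_A_flow:
  "i \<in> {1..q} \<Longrightarrow> integrable M (\<lambda>x. indicator (A i) (\<tau> k x) :: real)"
  by (rule integrable_flow) (simp add: emeasure_eq_measure)

lemma integral_indicator_A: "i \<in> {1..q} \<Longrightarrow> (LINT x|M. indicator (A i) x) = 1 / real q"
  using A_sets[of i] sets.sets_into_space[OF A_sets, of i] prob_A[of i]
  by (simp add: Int_absorb2)

text \<open>By invariance only the difference of the times matters. Expanding the product then
  leaves the covariance 1/q^2 - (1/q)(1/q) of two independent events.\<close>

lemma orthogonal_less:
  assumes ij: "i \<in> {1..q}" "j \<in> {1..q}" and "l < k"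
  shows "(LINT x|M. (indicator (A i) (\<tau> k x) - 1/q) * (indicator (A j) (\<tau> l x) - 1/q)) = (0::real)"
proof -
  note [measurable] = indicator_A_measurable[OF ij(1)] indicator_A_measurable[OF ij(2)]
    A_sets[OF ij(1)] A_sets[OF ij(2)]
  define d where "d = k - l"
  have d: "0 < d" using assms by (simp add: d_def)
  have "(LINT x|M. (indicator (A i) (\<tau> k x) - 1/q) * (indicator (A j) (\<tau> l x) - 1/q))
      = (LINT x|M. (indicator (A i) (\<tau> d (\<tau> l x)) - 1/q) * (indicator (A j) (\<tau> l x) - 1/q :: real))"
    by (rule Bochner_Integration.integral_cong) (simp_all add: flow_add d_def)
  also have "\<dots> = (LINT x|M. (indicator (A i) (\<tau> d x) - 1/q) * (indicator (A j) x - 1/q))"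
    by (rule integral_flow[of "\<lambda>x. (indicator (A i) (\<tau> d x) - 1/q) * (indicator (A j) x - 1/q)"])
      measurable
  also have "\<dots> = (LINT x|M. indicator {x \<in> space M. \<tau> d x \<in> A i \<and> x \<in> A j} x
      - indicator (A i) (\<tau> d x) / q - indicator (A j) x / q + 1 / (real q)\<^sup>2)"
    by (rule Bochner_Integration.integral_cong)
      (auto simp: indicator_def algebra_simps power2_eq_square)
  also have "\<dots> = 1 / (real q)\<^sup>2 - (1/q)/q - (1/q)/q + 1 / (real q)\<^sup>2"
  proof -
    have 1: "integrable M (\<lambda>x. indicator {x \<in> space M. \<tau> d x \<in> A i \<and> x \<in> A j} x :: real)"
      by (simp add: emeasure_eq_measure)
    have 2: "(LINT x|M. indicator {x \<in> space M. \<tau> d x \<in> A i \<and> x \<in> A j} x) = 1 / (real q)\<^sup>2"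
      using prob_A_flow[OF d ij]
      by (simp add: Int_absorb2 Collect_restrict)
    have 3: "(LINT x|M. indicator (A i) (\<tau> d x)) = 1 / real q"
      using integral_flow[of "indicator (A i)" d] integral_indicator_A[OF ij(1)] by simp
    note 4 = integrable_indicator_A_flow[OF ij(1), of d]
    have 5: "integrable M (\<lambda>x. indicator (A j) x :: real)"
      by (simp add: emeasure_eq_measure)
    show ?thesis
      using 1 4 5
      by (simp add: 2 3 integral_indicator_A[OF ij(2)] prob_space del: Bochner_Integration.integral_indicator)
  qed
  also have "\<dots> = 0"
    by (simp add: power2_eq_square)
  finally show ?thesis .
qed

lemma orthogonal:
  assumes "i \<in> {1..q}" "j \<in> {1..q}" "k \<noteq> l"
  shows "(LINT x|M. (indicator (A i) (\<tau> k x) - 1/q) * (indicator (A j) (\<tau> l x) - 1/q)) = (0::real)"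
proof (cases "l < k")
  case True
  then show ?thesis using orthogonal_less[OF assms(1,2)] by simp
next
  case False
  then have "k < l" using assms by simp
  from orthogonal_less[OF assms(2,1) this] show ?thesis by (simp add: mult.commute)
qed

text \<open>The products belonging to distinct times integrate to 0 by \<open>orthogonal\<close>, so
  only the variances of the summands \<open>X k\<close> remain. Here it is essential that
  \<open>S\<close> is a set, that is, that no time occurs twice.\<close>

lemma second_moment:
  fixes a :: "nat \<Rightarrow> int \<Rightarrow> real"
  assumes "finite S" and a: "\<And>i k. 0 \<le> a i k"
  defines "F \<equiv> \<lambda>x. \<Sum>k\<in>S. \<Sum>i=1..q. a i k * (indicator (A i) (\<tau> (- k) x) - 1/q)"
  shows "integrable M (\<lambda>x. (F x)\<^sup>2)" "(LINT x|M. (F x)\<^sup>2) \<le> (\<Sum>k\<in>S. (\<Sum>i=1..q. a i k)\<^sup>2) / q"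
proof -
  define X where "X k x = (\<Sum>i=1..q. a i k * (indicator (A i) (\<tau> (- k) x) - 1/q))" for k x
  have int2: "integrable M (\<lambda>x. (indicator (A i) (\<tau> k x) - 1/q) * (indicator (A j) (\<tau> l x) - 1/q) :: real)"
    if ij: "i \<in> {1..q}" "j \<in> {1..q}" for i j k l
  proof (rule integrable_const_bound[where B=1])
    note [measurable] = indicator_A_measurable[OF ij(1)] indicator_A_measurable[OF ij(2)]
    show "(\<lambda>x. (indicator (A i) (\<tau> k x) - 1/q) * (indicator (A j) (\<tau> l x) - 1/q) :: real) \<in> borel_measurable M"
      by measurable
    have "\<bar>indicator B x - 1/q\<bar> \<le> (1::real)" for B :: "'a set" and x
      using q_pos by (auto simp: indicator_def)
    then show "AE x in M. norm ((indicator (A i) (\<tau> k x) - 1/q) * (indicator (A j) (\<tau> l x) - 1/q) :: real) \<le> 1"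
      by (auto simp: abs_mult intro!: mult_le_one)
  qed
  have X_mult: "X k x * X l x = (\<Sum>i=1..q. \<Sum>j=1..q. (a i k * a j l) *
      ((indicator (A i) (\<tau> (- k) x) - 1/q) * (indicator (A j) (\<tau> (- l) x) - 1/q)))" for k l x
    unfolding X_def sum_product by (simp add: mult_ac)
  have XX: "integrable M (\<lambda>x. X k x * X l x)" for k l
    unfolding X_mult by (intro Bochner_Integration.integrable_sum integrable_mult_right int2)
  have X0: "(LINT x|M. X k x * X l x) = 0" if "k \<noteq> l" for k l
  proof -
    have "(LINT x|M. X k x * X l x) = (\<Sum>i=1..q. \<Sum>j=1..q. (a i k * a j l) *
        (LINT x|M. (indicator (A i) (\<tau> (- k) x) - 1/q) * (indicator (A j) (\<tau> (- l) x) - 1/q)))"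
      unfolding X_mult
      by (subst Bochner_Integration.integral_sum,
          intro Bochner_Integration.integrable_sum integrable_mult_right int2, assumption+,
          intro sum.cong refl, subst Bochner_Integration.integral_sum,
          intro integrable_mult_right int2, assumption+, intro sum.cong refl, simp)
    also have "\<dots> = 0"
      using that by (intro sum.neutral ballI) (simp add: orthogonal del: atLeastAtMost_iff)
    finally show ?thesis .
  qed
  have X2: "(LINT x|M. X k x * X k x) \<le> (\<Sum>i=1..q. a i k)\<^sup>2 / q" for k
  proof -
    define b where "b = (\<Sum>i=1..q. a i k)"
    define Z where "Z x = (\<Sum>i=1..q. a i k * indicator (A i) (\<tau> (- k) x))" for x
    have b: "0 \<le> b" unfolding b_def by (intro sum_nonneg a)
    have Z0: "0 \<le> Z x" for x unfolding Z_def by (intro sum_nonneg mult_nonneg_nonneg a) simp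
    have Zb: "Z x \<le> b" for x unfolding Z_def b_def
      by (intro sum_mono mult_left_le a) (simp add: indicator_def)
    have Zint: "integrable M Z"
      unfolding Z_def by (intro Bochner_Integration.integrable_sum integrable_mult_right integrable_indicator_A_flow)
    have "(LINT x|M. Z x) = (\<Sum>i=1..q. a i k * (LINT x|M. indicator (A i) (\<tau> (- k) x)))"
      unfolding Z_def by (subst Bochner_Integration.integral_sum)
        (auto intro!: integrable_mult_right integrable_indicator_A_flow)
    also have "\<dots> = (\<Sum>i=1..q. a i k * (1/q))"
      using integral_flow[OF indicator_A_measurable] integral_indicator_A by (intro sum.cong refl) auto
    finally have EZ: "(LINT x|M. Z x) = b / q"
      by (simp add: b_def sum_divide_distrib)
    have XZ: "X k x = Z x - b / q" for x
      unfolding X_def Z_def b_def by (simp add: algebra_simps sum_subtractf sum_divide_distrib)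
    \<comment> \<open>Since 0 \<le> Z \<le> b, the square of \<open>Z\<close> is at most b Z, and
      the mean b/q of \<open>Z\<close> controls its second moment.\<close>
    have "(LINT x|M. X k x * X k x) \<le> (LINT x|M. b * Z x - 2 * (b/q) * Z x + (b/q)\<^sup>2)"
    proof (rule integral_mono[OF XX])
      show "integrable M (\<lambda>x. b * Z x - 2 * (b/q) * Z x + (b/q)\<^sup>2)"
        using Zint by simp
      show "X k x * X k x \<le> b * Z x - 2 * (b/q) * Z x + (b/q)\<^sup>2" for x
        using mult_right_mono[OF Zb Z0, of x x] unfolding XZ by (simp add: algebra_simps power2_eq_square)
    qed
    also have "\<dots> = b\<^sup>2 / q - (b/q)\<^sup>2"
      using Zint by (simp add: EZ prob_space power2_eq_square)
    also have "\<dots> \<le> b\<^sup>2 / q" by simp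
    finally show ?thesis by (simp add: b_def)
  qed
  have F2: "(F x)\<^sup>2 = (\<Sum>k\<in>S. \<Sum>l\<in>S. X k x * X l x)" for x
    unfolding F_def X_def[symmetric] power2_eq_square sum_product ..
  show "integrable M (\<lambda>x. (F x)\<^sup>2)"
    unfolding F2 by (intro Bochner_Integration.integrable_sum XX)
  have "(LINT x|M. (F x)\<^sup>2) = (\<Sum>k\<in>S. \<Sum>l\<in>S. LINT x|M. X k x * X l x)"
    unfolding F2 by (simp add: Bochner_Integration.integral_sum Bochner_Integration.integrable_sum XX)
  also have "\<dots> = (\<Sum>k\<in>S. \<Sum>l\<in>S. if k = l then LINT x|M. X k x * X k x else 0)"
    by (intro sum.cong refl) (auto simp: X0)
  also have "\<dots> = (\<Sum>k\<in>S. LINT x|M. X k x * X k x)"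
    using \<open>finite S\<close> by simp
  also have "\<dots> \<le> (\<Sum>k\<in>S. (\<Sum>i=1..q. a i k)\<^sup>2 / q)"
    by (intro sum_mono X2)
  finally show "(LINT x|M. (F x)\<^sup>2) \<le> (\<Sum>k\<in>S. (\<Sum>i=1..q. a i k)\<^sup>2) / q"
    by (simp add: sum_divide_distrib)
qed

end

text \<open>\<open>c\<close> is the largest weight whose upper tail still carries the proportion
  \<eta> of the total; the smallest positive weight is a candidate. If the strict tail above
  \<open>c\<close> carried more than that proportion, the smallest weight in it would be a larger
  candidate.\<close>

lemma weighted_quantile:
  fixes b :: "'b \<Rightarrow> real"
  assumes "finite S" "\<And>k. k \<in> S \<Longrightarrow> 0 \<le> b k" "0 < sum b S" "0 < \<eta>" "\<eta> \<le> 1"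
  obtains c where "0 < c" "\<eta> * sum b S \<le> sum b {k\<in>S. c \<le> b k}" "sum b {k\<in>S. c < b k} \<le> \<eta> * sum b S"
proof -
  define V where "V = {v \<in> b ` S. 0 < v \<and> \<eta> * sum b S \<le> sum b {k\<in>S. v \<le> b k}}"
  have fV: "finite V" unfolding V_def using assms by simp
  have "V \<noteq> {}"
  proof -
    define U where "U = {k\<in>S. 0 < b k}"
    have U: "sum b U = sum b S"
      unfolding U_def using assms(1,2) by (intro sum.mono_neutral_left) force+
    then have ne: "U \<noteq> {}" using assms(3) by auto
    have fU: "finite U" unfolding U_def using assms by simp
    define v where "v = Min (b ` U)"
    have "v \<in> b ` U" unfolding v_def using ne fU by (intro Min_in) auto
    moreover have "\<And>k. k \<in> U \<Longrightarrow> v \<le> b k" unfolding v_def using fU by auto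
    ultimately have "{k\<in>S. v \<le> b k} = U" "v \<in> b ` S" "0 < v" unfolding U_def by force+
    moreover have "\<eta> * sum b S \<le> sum b S" using assms by simp
    ultimately have "v \<in> V" unfolding V_def using U by simp
    then show ?thesis by auto
  qed
  define c where "c = Max V"
  have "c \<in> V" unfolding c_def using fV \<open>V \<noteq> {}\<close> by (rule Max_in)
  have "sum b {k\<in>S. c < b k} \<le> \<eta> * sum b S"
  proof (rule ccontr)
    assume less: "\<not> ?thesis"
    define U where "U = {k\<in>S. c < b k}"
    have ne: "U \<noteq> {}" using less assms unfolding U_def by (auto simp del: Collect_empty_eq)
    have fU: "finite U" unfolding U_def using assms by simp
    define v where "v = Min (b ` U)"
    have "v \<in> b ` U" unfolding v_def using ne fU by (intro Min_in) auto
    moreover have "\<And>k. k \<in> U \<Longrightarrow> v \<le> b k" unfolding v_def using fU by auto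
    ultimately have "{k\<in>S. v \<le> b k} = U" "v \<in> b ` S" "c < v" unfolding U_def by force+
    moreover have "0 < c" using \<open>c \<in> V\<close> unfolding V_def by simp
    ultimately have "v \<in> V" unfolding V_def using less U_def by simp
    then have "v \<le> c" unfolding c_def using fV by simp
    then show False using \<open>c < v\<close> by simp
  qed
  with \<open>c \<in> V\<close> show thesis
    unfolding V_def by (intro that[of c]) auto
qed


section \<open>How much mass a single generating function can place correctly\<close>

context uniform_independent_partition
begin

text \<open>The terms on the right are the costs of four losses: points whose orbit often meets {h >
  2}, the discarded large weights (\<eta>), the mean number of hits (1/q), and the fluctuation
  around this mean (1/Q).\<close>

lemma mass_bound:
  fixes g :: "'a \<Rightarrow> real" and a :: "nat \<Rightarrow> int \<Rightarrow> real"
  assumes g: "integrable M g" "\<And>x. 0 \<le> g x"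
    and S: "finite S" and a: "\<And>i k. 0 \<le> a i k" and \<eta>: "0 < \<eta>" "\<eta> \<le> 1"
  defines "h \<equiv> \<lambda>x. \<Sum>k\<in>S. (\<Sum>i=1..q. a i k) * g (\<tau> k x)"
  shows "(\<Sum>i=1..q. LINT x|M. indicator (A i) x * (\<Sum>k\<in>S. a i k * g (\<tau> k x)))
    \<le> (LINT x|M. indicator {x. 2 < h x} x * h x) / \<eta>
        + (\<eta> + 1 / q) * (LINT x|M. h x) + ((LINT x|M. h x) + 1 / 2) / Q"
proof -
  define b where "b k = (\<Sum>i=1..q. a i k)" for k
  define \<beta> where "\<beta> = sum b S"
  define B where "B = {x \<in> space M. 2 < h x}"
  define \<Phi> where "\<Phi> y = (\<Sum>k\<in>S. \<Sum>i=1..q. a i k * indicator (A i) (\<tau> (- k) y))" for y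
  \<comment> \<open>The weighted number of visits of the points \<tau> (-k) y to \<open>B\<close>.
    Integrated against \<open>g\<close>, it returns the mass of \<open>h\<close> on
    \<open>B\<close>.\<close>
  define R where "R y = (\<Sum>k\<in>S. b k * indicator B (\<tau> (- k) y))" for y
  have b: "0 \<le> b k" for k unfolding b_def by (intro sum_nonneg a)
  have [measurable]: "g \<in> borel_measurable M" using g by simp
  have h: "h x = (\<Sum>k\<in>S. b k * g (\<tau> k x))" for x by (simp add: h_def b_def)
  have h_meas [measurable]: "h \<in> borel_measurable M" unfolding h by measurable
  have B [measurable]: "B \<in> sets M" unfolding B_def by measurable
  have int_g: "integrable M (\<lambda>y. indicator C (\<tau> k y) * g y)" if "C \<in> sets M" for C k
  proof (rule Bochner_Integration.integrable_bound[OF g(1)])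
    note that [measurable]
    show "(\<lambda>y. indicator C (\<tau> k y) * g y) \<in> borel_measurable M" by measurable
  qed (simp add: indicator_def)
  have int_h: "(LINT x|M. h x) = \<beta> * (LINT x|M. g x)"
    unfolding h \<beta>_def sum_distrib_right
    using g by (simp add: integrable_flow integral_flow)
  have int_hB: "(LINT x|M. indicator {x. 2 < h x} x * h x) = (LINT y|M. R y * g y)"
  proof -
    have "(LINT x|M. indicator {x. 2 < h x} x * h x)
        = (LINT x|M. (\<Sum>k\<in>S. b k * (indicator B x * g (\<tau> k x))))"
      by (rule Bochner_Integration.integral_cong) (auto simp: B_def h indicator_def)
    also have "\<dots> = (\<Sum>k\<in>S. b k * (LINT x|M. indicator B x * g (\<tau> k x)))"
      using integrable_flow[OF int_g[OF B]]
      by (subst Bochner_Integration.integral_sum)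
         (auto intro!: Bochner_Integration.integrable_bound[OF integrable_flow[OF g(1)]] simp: indicator_def)
    also have "\<dots> = (\<Sum>k\<in>S. b k * (LINT y|M. indicator B (\<tau> (- k) y) * g y))"
      by (simp add: integral_mult_flow)
    also have "\<dots> = (LINT y|M. R y * g y)"
      unfolding R_def sum_distrib_right mult.assoc by (simp add: int_g)
    finally show ?thesis .
  qed
  have int_\<Phi>: "integrable M (\<lambda>y. \<Phi> y * g y)"
    unfolding \<Phi>_def sum_distrib_right mult.assoc
    by (intro Bochner_Integration.integrable_sum integrable_mult_right int_g A_sets)
  have int_R: "integrable M (\<lambda>y. R y * g y)"
    unfolding R_def sum_distrib_right mult.assoc
    by (intro Bochner_Integration.integrable_sum integrable_mult_right int_g B)
  \<comment> \<open>Moving every shift onto the indicators turns the correctly placed mass into the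
    integral of \<Phi> against \<open>g\<close>.\<close>
  have P: "(\<Sum>i=1..q. LINT x|M. indicator (A i) x * (\<Sum>k\<in>S. a i k * g (\<tau> k x))) = (LINT y|M. \<Phi> y * g y)"
  proof -
    have "(LINT x|M. indicator (A i) x * (\<Sum>k\<in>S. a i k * g (\<tau> k x)))
        = (\<Sum>k\<in>S. a i k * (LINT y|M. indicator (A i) (\<tau> (- k) y) * g y))" if i: "i \<in> {1..q}" for i
    proof -
      note [measurable] = A_sets[OF i]
      have "(LINT x|M. indicator (A i) x * (\<Sum>k\<in>S. a i k * g (\<tau> k x)))
          = (LINT x|M. (\<Sum>k\<in>S. a i k * (indicator (A i) x * g (\<tau> k x))))"
        by (simp add: sum_distrib_left mult_ac)
      also have "\<dots> = (\<Sum>k\<in>S. a i k * (LINT x|M. indicator (A i) x * g (\<tau> k x)))"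
        by (subst Bochner_Integration.integral_sum)
           (auto intro!: Bochner_Integration.integrable_bound[OF integrable_flow[OF g(1)]] simp: indicator_def)
      finally show ?thesis by (simp add: integral_mult_flow)
    qed
    then have "(\<Sum>i=1..q. LINT x|M. indicator (A i) x * (\<Sum>k\<in>S. a i k * g (\<tau> k x)))
        = (\<Sum>i=1..q. \<Sum>k\<in>S. a i k * (LINT y|M. indicator (A i) (\<tau> (- k) y) * g y))"
      by (intro sum.cong refl)
    also have "\<dots> = (\<Sum>k\<in>S. \<Sum>i=1..q. a i k * (LINT y|M. indicator (A i) (\<tau> (- k) y) * g y))"
      by (rule sum.swap)
    also have "\<dots> = (LINT y|M. \<Phi> y * g y)"
      unfolding \<Phi>_def sum_distrib_right mult.assoc
      by (subst Bochner_Integration.integral_sum,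
          intro Bochner_Integration.integrable_sum integrable_mult_right int_g A_sets, assumption)
         (intro sum.cong refl, subst Bochner_Integration.integral_sum,
          auto intro!: integrable_mult_right int_g A_sets)
    finally show ?thesis .
  qed
  have \<Phi>_le: "(\<Sum>k\<in>S'. \<Sum>i=1..q. a i k * indicator (A i) (\<tau> (- k) y)) \<le> sum b S'" for y S'
    unfolding b_def by (intro sum_mono mult_left_le a) (simp add: indicator_def)
  have \<beta>0: "0 \<le> \<beta>" unfolding \<beta>_def by (intro sum_nonneg b)
  show ?thesis
  \<comment> \<open>A quantile exists only for positive total weight. If the total is 0, the left
    side vanishes and the right side reduces to 1/(2 Q).\<close>
  proof (cases "\<beta> = 0")
    case True
    have "R y = 0" for y
      using True S b unfolding R_def \<beta>_def by (simp add: sum_nonneg_eq_0_iff)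
    moreover have "\<Phi> y = 0" for y
      using \<Phi>_le[of y S] True unfolding \<Phi>_def \<beta>_def
      by (intro antisym sum_nonneg mult_nonneg_nonneg a) auto
    ultimately show ?thesis
      unfolding P int_hB int_h by (simp add: True)
  next
    case False
    then have \<beta>: "0 < \<beta>" using \<beta>0 by simp
    \<comment> \<open>At a quantile \<open>c\<close> of the weights, discarding the weights above \<open>c\<close> costs little and makes
      \<open>\<Sum>b\<^sup>2 \<le> c \<beta>\<close>, while the weights \<open>\<ge> c\<close> are numerous enough to force \<open>g y \<le> 2 / c\<close> at every \<open>y\<close>
      whose orbit rarely meets \<open>{h > 2}\<close>.\<close>
    obtain c where c: "0 < c" "\<eta> * \<beta> \<le> sum b {k\<in>S. c \<le> b k}" "sum b {k\<in>S. c < b k} \<le> \<eta> * \<beta>"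
      using weighted_quantile[of S b \<eta>] S b \<beta> \<eta> unfolding \<beta>_def by metis
    define S1 where "S1 = {k\<in>S. b k \<le> c}"
    define F where "F y = (\<Sum>k\<in>S1. \<Sum>i=1..q. a i k * (indicator (A i) (\<tau> (- k) y) - 1/q))" for y
    have S1: "finite S1" "S1 \<subseteq> S" unfolding S1_def using S by auto
    have F_int: "integrable M (\<lambda>y. (F y)\<^sup>2)"
      and F2: "(LINT y|M. (F y)\<^sup>2) \<le> (\<Sum>k\<in>S1. (b k)\<^sup>2) / q"
      unfolding F_def b_def by (rule second_moment[OF S1(1) a])+
    have "(\<Sum>k\<in>S1. (b k)\<^sup>2) \<le> (\<Sum>k\<in>S1. c * b k)"
      unfolding power2_eq_square S1_def using b by (intro sum_mono mult_right_mono) auto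
    also have "\<dots> \<le> c * \<beta>"
      unfolding sum_distrib_left[symmetric] \<beta>_def
      using c(1) b S S1 by (intro mult_left_mono sum_mono2) auto
    finally have "(\<Sum>k\<in>S1. (b k)\<^sup>2) / q \<le> c * \<beta> / q"
      by (simp add: divide_right_mono)
    with F2 have F2: "(LINT y|M. (F y)\<^sup>2) \<le> c * \<beta> / q" by simp
    \<comment> \<open>The parameter for splitting the product of \<open>F\<close> and
      \<open>g\<close> by the arithmetic-geometric mean inequality. With g \<le> 2/c the first part
      costs (\<beta>/Q) g, and the second part integrates to at most (c \<beta>/q)/(2 s) = 1/(2 Q),
      because q = Q^2.\<close>
    define s where "s = c * \<beta> / Q"
    have s: "0 < s" using c \<beta> Q_pos by (simp add: s_def)
    have R0: "0 \<le> R y" for y unfolding R_def by (intro sum_nonneg mult_nonneg_nonneg b) simp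
    \<comment> \<open>Weights above \<open>c\<close> contribute at most \<eta> \<beta> in all. For
      the others, the number of hits is its mean, which is at most \<beta>/q, plus the centred sum
      \<open>F\<close>.\<close>
    have split: "\<Phi> y \<le> \<eta> * \<beta> + F y + \<beta> / q" for y
    proof -
      have "\<Phi> y = (\<Sum>k\<in>{k\<in>S. c < b k}. \<Sum>i=1..q. a i k * indicator (A i) (\<tau> (- k) y))
          + (\<Sum>k\<in>S1. \<Sum>i=1..q. a i k * indicator (A i) (\<tau> (- k) y))"
      proof -
        have "S = {k\<in>S. c < b k} \<union> S1" unfolding S1_def by auto
        moreover have "{k\<in>S. c < b k} \<inter> S1 = {}" unfolding S1_def by auto
        ultimately show ?thesis
          unfolding \<Phi>_def using S S1 by (metis (no_types, lifting) finite_Un sum.union_disjoint)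
      qed
      moreover have "(\<Sum>k\<in>S1. \<Sum>i=1..q. a i k * indicator (A i) (\<tau> (- k) y)) = F y + sum b S1 / q"
        unfolding F_def b_def
        by (simp add: algebra_simps sum_subtractf sum_divide_distrib)
      moreover have "sum b S1 / q \<le> \<beta> / q"
        unfolding \<beta>_def using S S1 b by (intro divide_right_mono sum_mono2) auto
      ultimately show ?thesis
        using \<Phi>_le[of y "{k\<in>S. c < b k}"] c(3) by linarith
    qed
    have pointwise: "\<Phi> y * g y \<le> R y * g y / \<eta> + (\<eta> + 1 / q) * \<beta> * g y + \<beta> / Q * g y + (F y)\<^sup>2 / (2 * s)"
      if y: "y \<in> space M" for y
    proof (cases "\<eta> * \<beta> \<le> R y")
      case True
      \<comment> \<open>On an orbit with many visits to \<open>B\<close> the trivial bound \<beta>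
        for \<Phi> is already paid for by R/\<eta>.\<close>
      have "\<Phi> y \<le> \<beta>" using \<Phi>_le[of y S] by (simp add: \<Phi>_def \<beta>_def)
      also have "\<beta> \<le> R y / \<eta>" using True \<eta> by (simp add: pos_le_divide_eq mult.commute)
      finally have "\<Phi> y * g y \<le> R y / \<eta> * g y" using g by (intro mult_right_mono) auto
      moreover have "0 \<le> (\<eta> + 1 / q) * \<beta> * g y" "0 \<le> \<beta> / Q * g y" "0 \<le> (F y)\<^sup>2 / (2 * s)"
        using \<eta> \<beta> g s by simp_all
      ultimately show ?thesis by simp
    next
      case False
      \<comment> \<open>If all times of weight at least \<open>c\<close> led into \<open>B\<close>,
        they alone would bring \<open>R y\<close> up to \<eta> \<beta>. A time that avoids
        \<open>B\<close> bounds \<open>g y\<close>, since b k * g y is one summand of h (\<tau> (-k)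
        y) \<le> 2.\<close>
      have "\<exists>k\<in>S. c \<le> b k \<and> \<tau> (- k) y \<notin> B"
      proof (rule ccontr)
        assume "\<not> ?thesis"
        then have "sum b {k\<in>S. c \<le> b k} = (\<Sum>k\<in>{k\<in>S. c \<le> b k}. b k * indicator B (\<tau> (- k) y))"
          by (intro sum.cong) (auto simp: indicator_def)
        also have "\<dots> \<le> R y"
          unfolding R_def using S b by (intro sum_mono2) auto
        finally show False using False c(2) by simp
      qed
      then obtain k where k: "k \<in> S" "c \<le> b k" "\<tau> (- k) y \<notin> B" by auto
      have "c * g y \<le> b k * g (\<tau> k (\<tau> (- k) y))"
        using k g y by (simp add: flow_inverse mult_right_mono)
      also have "\<dots> \<le> h (\<tau> (- k) y)"
        unfolding h using S b g k(1)
        by (intro member_le_sum[of k S "\<lambda>k'. b k' * g (\<tau> k' (\<tau> (- k) y))"]) auto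
      also have "\<dots> \<le> 2" using k(3) flow_space[OF y] by (simp add: B_def not_less)
      finally have gc: "c * g y \<le> 2" .
      have "F y * g y \<le> (g y)\<^sup>2 * s / 2 + (F y)\<^sup>2 / (2 * s)"
      proof -
        have "0 \<le> (s * g y - F y)\<^sup>2 / (2 * s)" using s by simp
        also have "\<dots> = (g y)\<^sup>2 * s / 2 + (F y)\<^sup>2 / (2 * s) - F y * g y"
          using s by (simp add: field_simps power2_eq_square)
        finally show ?thesis by simp
      qed
      moreover have "(g y)\<^sup>2 * s / 2 \<le> \<beta> / Q * g y"
      proof -
        have "(g y)\<^sup>2 * s / 2 = (c * g y) * (\<beta> / Q * g y / 2)"
          by (simp add: s_def power2_eq_square)
        also have "\<dots> \<le> 2 * (\<beta> / Q * g y / 2)"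
          using gc \<beta> g by (intro mult_right_mono) auto
        finally show ?thesis by simp
      qed
      moreover have "\<Phi> y * g y \<le> (\<eta> * \<beta> + F y + \<beta> / q) * g y"
        using split[of y] g by (intro mult_right_mono) auto
      moreover have "(\<eta> * \<beta> + F y + \<beta> / q) * g y = (\<eta> + 1 / q) * \<beta> * g y + F y * g y"
        by (simp add: algebra_simps)
      moreover have "0 \<le> R y * g y / \<eta>" using R0 g \<eta> by simp
      ultimately show ?thesis by linarith
    qed
    have "(LINT y|M. \<Phi> y * g y)
        \<le> (LINT y|M. R y * g y / \<eta> + (\<eta> + 1 / q) * \<beta> * g y + \<beta> / Q * g y + (F y)\<^sup>2 / (2 * s))"
      using int_R g F_int by (intro integral_mono[OF int_\<Phi>] pointwise) auto
    also have "\<dots> = (LINT y|M. R y * g y) / \<eta> + (\<eta> + 1 / q) * \<beta> * (LINT y|M. g y)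
        + \<beta> / Q * (LINT y|M. g y) + (LINT y|M. (F y)\<^sup>2) / (2 * s)"
      using int_R g F_int by simp
    also have "(LINT y|M. (F y)\<^sup>2) / (2 * s) \<le> (c * \<beta> / q) / (2 * s)"
      using F2 s by (intro divide_right_mono) auto
    also have "(c * \<beta> / q) / (2 * s) = 1 / 2 / Q"
      using c \<beta> Q_pos by (simp add: s_def q_eq power2_eq_square)
    finally show ?thesis
      unfolding P int_hB int_h by (simp add: algebra_simps add_divide_distrib)
  qed
qed

text \<open>Summed over the \<open>n\<close> generating functions, the proportional losses in
  \<open>mass_bound\<close> are taken from a total mass of about 1, whatever \<open>n\<close> is.
  Only the additive 1/(2 Q) is paid \<open>n\<close> times, and 16 n \<le> Q keeps this below
  1/32.\<close>

lemma not_AT: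
  assumes n: "1 \<le> n" and Q: "16 * n \<le> Q"
    and T: "\<And>k x. x \<in> space M \<Longrightarrow> int_iter (space M) T k x = \<tau> k x"
  shows "\<not> AT M T n"
proof
  assume AT: "AT M T n"
  \<comment> \<open>Chosen so that q \<epsilon> \<le> 1/256 and so that the large values of the
    \<open>n\<close> functions \<open>h m\<close> cost 32 n q \<epsilon> = 1/8 in all.\<close>
  define \<epsilon> where "\<epsilon> = 1 / (256 * real n * real q)"
  have \<epsilon>: "0 < \<epsilon>" using n q_pos by (simp add: \<epsilon>_def)
  have A1: "\<forall>i\<in>{1..q}. indicator (A i) \<in> L1_nonneg M"
    using A_sets by (auto simp: L1_nonneg_def emeasure_eq_measure)
  obtain g :: "nat \<Rightarrow> 'a \<Rightarrow> real" and N :: nat and a t where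
    g: "\<forall>m\<in>{1..n}. g m \<in> L1_nonneg M" and
    a: "\<forall>m\<in>{1..n}. \<forall>i\<in>{1..q}. \<forall>j\<in>{1..N}. 0 \<le> a m i j" and
    app: "\<forall>i\<in>{1..q}. L1_norm M (\<lambda>x. indicator (A i) x -
        (\<Sum>m=1..n. \<Sum>j=1..N. a m i j * g m (int_iter (space M) T (t m j) x))) < \<epsilon>"
    using AT[unfolded AT_def, THEN spec, THEN mp, THEN spec, THEN spec, THEN mp, OF \<epsilon> A1]
    by blast
  \<comment> \<open>The times \<open>t m j\<close> may repeat, so the coefficients of equal times are added up.\<close>
  define g' where "g' m x = max 0 (g m x)" for m x
  \<comment> \<open>\<open>mass_bound\<close> asks for nonnegative coefficients at every index
    \<open>i\<close>, hence the value 0 outside {1..q}.\<close>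
  define c where "c m i k = (if i \<in> {1..q} then \<Sum>j\<in>{j. j \<in> {1..N} \<and> t m j = k}. a m i j else 0)" for m i k
  define K where "K m i x = (\<Sum>k\<in>t m ` {1..N}. c m i k * g' m (\<tau> k x))" for m i x
  define h where "h m x = (\<Sum>k\<in>t m ` {1..N}. (\<Sum>i=1..q. c m i k) * g' m (\<tau> k x))" for m x
  define H where "H x = (\<Sum>m=1..n. h m x)" for x
  have g'_int: "integrable M (g' m)" if "m \<in> {1..n}" for m
    unfolding g'_def using g that by (auto simp: L1_nonneg_def)
  have g'0: "0 \<le> g' m x" for m x by (simp add: g'_def)
  have c0: "0 \<le> c m i k" if "m \<in> {1..n}" for m i k
    using a that by (auto simp: c_def intro!: sum_nonneg)
  have K_int: "integrable M (K m i)" if "m \<in> {1..n}" for m i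
    unfolding K_def by (intro Bochner_Integration.integrable_sum integrable_mult_right integrable_flow g'_int that)
  have hK: "h m x = (\<Sum>i=1..q. K m i x)" for m x
    unfolding h_def K_def sum_distrib_right by (rule sum.swap)
  have h0: "0 \<le> h m x" if "m \<in> {1..n}" for m x
    unfolding h_def by (intro sum_nonneg mult_nonneg_nonneg c0 g'0 that)
  have h_int: "integrable M (h m)" if "m \<in> {1..n}" for m
    unfolding hK by (intro Bochner_Integration.integrable_sum K_int that)
  have H_int: "integrable M H"
    unfolding H_def by (intro Bochner_Integration.integrable_sum h_int)
  have A_int: "integrable M (\<lambda>x. indicator (A i) x :: real)" if "i \<in> {1..q}" for i
    using A_sets[OF that] by (simp add: emeasure_eq_measure)
  define D where "D i x = indicator (A i) x - (\<Sum>m=1..n. K m i x)" for i x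
  have D_int: "integrable M (D i)" if "i \<in> {1..q}" for i
    unfolding D_def using that
    by (intro Bochner_Integration.integrable_diff Bochner_Integration.integrable_sum K_int A_int)
  have D: "(LINT x|M. \<bar>D i x\<bar>) \<le> \<epsilon>" if i: "i \<in> {1..q}" for i
  proof -
    \<comment> \<open>\<open>g m\<close> is nonnegative only almost everywhere, whereas
      \<open>mass_bound\<close> needs this everywhere; hence the truncation \<open>g'\<close>. There
      are countably many pairs of \<open>m\<close> and \<open>k\<close>, so outside one null set the
      truncation changes no term.\<close>
    have "AE x in M. \<forall>m\<in>{1..n}. \<forall>k. 0 \<le> g m (\<tau> k x)"
      using g by (auto simp: AE_ball_countable AE_all_countable L1_nonneg_def intro!: AE_flow)
    then have ae: "AE x in M. \<bar>indicator (A i) x - (\<Sum>m=1..n. \<Sum>j=1..N. a m i j * g m (\<tau> (t m j) x))\<bar> = \<bar>D i x\<bar>"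
    proof eventually_elim
      case (elim x)
      have "(\<Sum>j=1..N. a m i j * g m (\<tau> (t m j) x)) = K m i x" if m: "m \<in> {1..n}" for m
      proof -
        have "(\<Sum>j=1..N. a m i j * g m (\<tau> (t m j) x)) = (\<Sum>j=1..N. a m i j * g' m (\<tau> (t m j) x))"
          using elim m by (simp add: g'_def)
        also have "\<dots> = (\<Sum>k\<in>t m ` {1..N}. \<Sum>j\<in>{j. j \<in> {1..N} \<and> t m j = k}. a m i j * g' m (\<tau> (t m j) x))"
          by (rule sum.image_gen) simp
        also have "\<dots> = K m i x"
          unfolding K_def using i by (intro sum.cong refl) (simp add: c_def sum_distrib_right)
        finally show ?thesis .
      qed
      then show ?case by (simp add: D_def)
    qed
    have "L1_norm M (\<lambda>x. indicator (A i) x -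
        (\<Sum>m=1..n. \<Sum>j=1..N. a m i j * g m (int_iter (space M) T (t m j) x)))
      = (LINT x|M. \<bar>indicator (A i) x - (\<Sum>m=1..n. \<Sum>j=1..N. a m i j * g m (\<tau> (t m j) x))\<bar>)"
      unfolding L1_norm_def by (rule Bochner_Integration.integral_cong) (simp_all add: T)
    also have "\<dots> = (LINT x|M. \<bar>D i x\<bar>)"
    proof (rule integral_cong_AE)
      have "integrable M (\<lambda>x. \<Sum>m=1..n. \<Sum>j=1..N. a m i j * g m (\<tau> (t m j) x))"
        using g by (intro Bochner_Integration.integrable_sum integrable_mult_right integrable_flow)
          (auto simp: L1_nonneg_def)
      then show "(\<lambda>x. \<bar>indicator (A i) x - (\<Sum>m=1..n. \<Sum>j=1..N. a m i j * g m (\<tau> (t m j) x))\<bar>)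
          \<in> borel_measurable M"
        using A_int[OF i] by (intro borel_measurable_abs borel_measurable_diff borel_measurable_integrable)
      show "(\<lambda>x. \<bar>D i x\<bar>) \<in> borel_measurable M"
        using D_int[OF i] by simp
    qed (rule ae)
    finally show ?thesis using app i by force
  qed
  have E1: "(LINT x|M. \<bar>1 - H x\<bar>) \<le> q * \<epsilon>"
  proof -
    have "1 - H x = (\<Sum>i=1..q. D i x)" if "x \<in> space M" for x
      using A_partition[OF that] sum.swap[of "\<lambda>m i. K m i x" "{1..q}" "{1..n}"]
      unfolding D_def H_def hK sum_subtractf by simp
    then have "(LINT x|M. \<bar>1 - H x\<bar>) \<le> (LINT x|M. (\<Sum>i=1..q. \<bar>D i x\<bar>))"
      using H_int D_int by (intro integral_mono) (auto intro!: sum_abs)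
    also have "\<dots> = (\<Sum>i=1..q. LINT x|M. \<bar>D i x\<bar>)"
      using D_int by (intro Bochner_Integration.integral_sum) auto
    also have "\<dots> \<le> (\<Sum>i=1..q. \<epsilon>)" by (intro sum_mono D)
    finally show ?thesis by simp
  qed
  \<comment> \<open>Where h m > 2 also H > 2, and then h m \<le> H \<le> 2 (H - 1). This is what the
    threshold 2 is for.\<close>
  have large: "(LINT x|M. indicator {x. 2 < h m x} x * h m x) \<le> 2 * (q * \<epsilon>)" if m: "m \<in> {1..n}" for m
  proof -
    have [measurable]: "h m \<in> borel_measurable M" using h_int[OF m] by simp
    have "(LINT x|M. indicator {x. 2 < h m x} x * h m x) \<le> (LINT x|M. 2 * \<bar>1 - H x\<bar>)"
    proof (rule integral_mono)
      show "integrable M (\<lambda>x. indicator {x. 2 < h m x} x * h m x)"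
      proof (rule Bochner_Integration.integrable_bound[OF h_int[OF m]])
        show "(\<lambda>x. indicator {x. 2 < h m x} x * h m x) \<in> borel_measurable M" by measurable
      qed (simp add: indicator_def)
      show "indicator {x. 2 < h m x} x * h m x \<le> 2 * \<bar>1 - H x\<bar>" for x
      proof -
        have "h m x \<le> H x" unfolding H_def using m h0 by (intro member_le_sum) auto
        then show ?thesis by (auto simp: indicator_def)
      qed
    qed (use H_int in simp)
    then show ?thesis using E1 by simp
  qed
  have W: "(\<Sum>m=1..n. LINT x|M. h m x) \<le> 1 + q * \<epsilon>"
  proof -
    have "(\<Sum>m=1..n. LINT x|M. h m x) = (LINT x|M. H x)"
      unfolding H_def by (rule Bochner_Integration.integral_sum[symmetric]) (rule h_int)
    also have "\<dots> \<le> (LINT x|M. 1 + \<bar>1 - H x\<bar>)"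
      using H_int by (intro integral_mono) auto
    also have "\<dots> = 1 + (LINT x|M. \<bar>1 - H x\<bar>)"
      using H_int by (simp add: prob_space)
    finally show ?thesis using E1 by simp
  qed
  have AK_int: "integrable M (\<lambda>x. indicator (A i) x * K m i x)" if "i \<in> {1..q}" "m \<in> {1..n}" for i m
    using integrable_mult_indicator[OF A_sets[OF that(1)] K_int[OF that(2), of i]] by simp
  \<comment> \<open>A lower bound for the correctly placed mass: on its strip of measure 1/q, the
    \<open>i\<close>-th approximant falls short of the indicator by at most \<epsilon> in the
    mean.\<close>
  have "1 - q * \<epsilon> = (\<Sum>i=1..q. 1 / q - \<epsilon>)"
    using q_pos by (simp add: right_diff_distrib)
  also have "\<dots> \<le> (\<Sum>i=1..q. \<Sum>m=1..n. LINT x|M. indicator (A i) x * K m i x)"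
  proof (rule sum_mono)
    fix i assume i: "i \<in> {1..q}"
    have "1 / q - \<epsilon> \<le> (LINT x|M. indicator (A i) x) - (LINT x|M. \<bar>D i x\<bar>)"
      using D[OF i] integral_indicator_A[OF i] by simp
    also have "\<dots> = (LINT x|M. indicator (A i) x - \<bar>D i x\<bar>)"
      using A_int[OF i] D_int[OF i] by simp
    also have "\<dots> \<le> (LINT x|M. (\<Sum>m=1..n. indicator (A i) x * K m i x))"
    proof (rule integral_mono)
      show "indicator (A i) x - \<bar>D i x\<bar> \<le> (\<Sum>m=1..n. indicator (A i) x * K m i x)" for x
        by (auto simp: D_def indicator_def)
    qed (intro Bochner_Integration.integrable_diff Bochner_Integration.integrable_sum integrable_abs
        A_int D_int AK_int i, assumption?)+
    also have "\<dots> = (\<Sum>m=1..n. LINT x|M. indicator (A i) x * K m i x)"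
      by (intro Bochner_Integration.integral_sum AK_int i)
    finally show "1 / q - \<epsilon> \<le> \<dots>" .
  qed
  also have "\<dots> = (\<Sum>m=1..n. \<Sum>i=1..q. LINT x|M. indicator (A i) x * K m i x)"
    by (rule sum.swap)
  \<comment> \<open>\<open>mass_bound\<close> with \<eta> = 1/16. Since 1/q and 1/Q are at most 1/16
    as well, the factor of the total mass becomes 3/16 below.\<close>
  also have "\<dots> \<le> (\<Sum>m=1..n. 2 * (q * \<epsilon>) / (1/16) + (1/16 + 1 / q) * (LINT x|M. h m x)
      + ((LINT x|M. h m x) + 1 / 2) / Q)"
  proof (rule sum_mono)
    fix m assume m: "m \<in> {1..n}"
    have "(\<Sum>i=1..q. LINT x|M. indicator (A i) x * K m i x)
      \<le> (LINT x|M. indicator {x. 2 < h m x} x * h m x) / (1/16)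
        + (1/16 + 1 / q) * (LINT x|M. h m x) + ((LINT x|M. h m x) + 1 / 2) / Q"
      unfolding K_def h_def
      by (rule mass_bound) (use g'_int[OF m] g'0 c0[OF m] in auto)
    then show "(\<Sum>i=1..q. LINT x|M. indicator (A i) x * K m i x)
      \<le> 2 * (q * \<epsilon>) / (1/16) + (1/16 + 1 / q) * (LINT x|M. h m x) + ((LINT x|M. h m x) + 1 / 2) / Q"
      by (rule order_trans) (intro add_right_mono divide_right_mono large m, simp)
  qed
  also have "\<dots> = 32 * (n * (q * \<epsilon>)) + (1/16 + 1/q + 1/Q) * (\<Sum>m=1..n. LINT x|M. h m x) + n / (2 * Q)"
    by (simp add: sum.distrib sum_distrib_left[symmetric] sum_divide_distrib[symmetric]
        add_divide_distrib distrib_right)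
  finally have main: "1 - q * \<epsilon>
    \<le> 32 * (n * (q * \<epsilon>)) + (1/16 + 1/q + 1/Q) * (\<Sum>m=1..n. LINT x|M. h m x) + n / (2 * Q)" .
  have nq: "n * (q * \<epsilon>) = 1 / 256" using n q_pos by (simp add: \<epsilon>_def)
  have q\<epsilon>: "q * \<epsilon> \<le> 1 / 256" using n q_pos by (simp add: \<epsilon>_def field_simps)
  have nQ: "n / (2 * Q) \<le> 1 / 32" using Q Q_pos by (simp add: field_simps)
  have Q16: "16 \<le> real Q" using Q n by linarith
  then have "1 / Q \<le> 1 / 16" by (simp add: field_simps)
  moreover have "1 / q \<le> 1 / 16"
  proof -
    have "real Q * 1 \<le> real Q * real Q" using Q16 by (intro mult_left_mono) auto
    also have "\<dots> = real q" by (simp add: q_eq power2_eq_square)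
    finally have "16 \<le> real q" using Q16 by linarith
    then show ?thesis by (simp add: field_simps)
  qed
  ultimately have X: "(1/16 + 1/q + 1/Q) * (\<Sum>m=1..n. LINT x|M. h m x) \<le> (3/16) * (1 + q * \<epsilon>)"
    using W h0 by (intro mult_mono sum_nonneg integral_nonneg_AE) auto
  \<comment> \<open>The left side is at least 255/256, while the right side is at most 1/8 +
    (3/16)(257/256) + 1/32 < 1/2.\<close>
  have "\<not> 1 - w \<le> 32 * (1 / 256) + x + y"
    if "w \<le> 1 / 256" "y \<le> 1 / 32" "x \<le> (3/16) * (1 + w)" for w x y :: real
    using that by simp
  from this[OF q\<epsilon> nQ X] main[unfolded nq] show False by (rule notE)
qed

end

section \<open>The skew product on the torus\<close>

lemma borel_measurable_frac [measurable]: "(frac :: real \<Rightarrow> real) \<in> borel_measurable borel"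
  unfolding frac_def by measurable

text \<open>Shift the interval by an integer to [d, 1 + d) with d = frac c and cut it at 1; the
  piece beyond 1 moves back onto [0, d).\<close>

lemma nn_integral_frac_period:
  fixes f :: "real \<Rightarrow> ennreal"
  assumes [measurable]: "f \<in> borel_measurable borel"
  shows "(\<integral>\<^sup>+x. f (frac x) * indicator {c..<c+1} x \<partial>lborel) = (\<integral>\<^sup>+x. f x * indicator {0..<1} x \<partial>lborel)"
proof -
  define d where "d = frac c"
  define m where "m = \<lfloor>c\<rfloor>"
  have c: "c = m + d" by (simp add: d_def m_def frac_def)
  have d: "0 \<le> d" "d < 1" by (simp_all add: d_def frac_lt_1)
  have shift: "(\<integral>\<^sup>+x. F x \<partial>lborel) = (\<integral>\<^sup>+x. F (s + x) \<partial>lborel)"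
    if "F \<in> borel_measurable borel" for s :: real and F :: "real \<Rightarrow> ennreal"
    using nn_integral_real_affine[OF that, of 1 s] by simp
  have "(\<integral>\<^sup>+x. f (frac x) * indicator {c..<c+1} x \<partial>lborel)
      = (\<integral>\<^sup>+x. f (frac (m + x)) * indicator {c..<c+1} (m + x) \<partial>lborel)"
    by (subst shift[where s="real_of_int m"]) simp_all
  also have "\<dots> = (\<integral>\<^sup>+x. f (frac x) * indicator {d..<1} x + f (frac x) * indicator {1..<1+d} x \<partial>lborel)"
    using d by (intro nn_integral_cong) (auto simp: c indicator_def add_ac)
  also have "\<dots> = (\<integral>\<^sup>+x. f (frac x) * indicator {d..<1} x \<partial>lborel) + (\<integral>\<^sup>+x. f (frac x) * indicator {1..<1+d} x \<partial>lborel)"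
    by (subst nn_integral_add) simp_all
  also have "(\<integral>\<^sup>+x. f (frac x) * indicator {1..<1+d} x \<partial>lborel)
      = (\<integral>\<^sup>+x. f (frac (1 + x)) * indicator {1..<1+d} (1 + x) \<partial>lborel)"
    by (subst shift[where s=1]) simp_all
  also have "\<dots> = (\<integral>\<^sup>+x. f (frac x) * indicator {0..<d} x \<partial>lborel)"
    by (intro nn_integral_cong) (auto simp: indicator_def add.commute[of 1] frac_1_eq)
  also have "(\<integral>\<^sup>+x. f (frac x) * indicator {d..<1} x \<partial>lborel) + \<dots>
      = (\<integral>\<^sup>+x. f (frac x) * indicator {d..<1} x + f (frac x) * indicator {0..<d} x \<partial>lborel)"
    by (subst nn_integral_add) simp_all
  also have "\<dots> = (\<integral>\<^sup>+x. f x * indicator {0..<1} x \<partial>lborel)"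
    using d by (intro nn_integral_cong) (auto simp: indicator_def frac_eq)
  finally show ?thesis .
qed

text \<open>The map x to c + k x sweeps over \<open>k\<close> full periods, and the factor
  \<open>k\<close> of the substitution cancels. The case k = 1 gives invariance under rotations;
  larger \<open>k\<close> gives the independence of the strips.\<close>

lemma nn_integral_frac_affine:
  fixes f :: "real \<Rightarrow> ennreal" and k :: nat
  assumes [measurable]: "f \<in> borel_measurable borel" and k: "0 < k"
  shows "(\<integral>\<^sup>+x. f (frac (c + k * x)) * indicator {0..<1} x \<partial>lborel) = (\<integral>\<^sup>+x. f x * indicator {0..<1} x \<partial>lborel)"
    (is "?L = ?J")
proof -
  have periods: "(\<integral>\<^sup>+x. f (frac x) * indicator {c..<c + real l} x \<partial>lborel) = of_nat l * ?J" for l :: nat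
  proof (induction l)
    case (Suc l)
    have "(\<integral>\<^sup>+x. f (frac x) * indicator {c..<c + real (Suc l)} x \<partial>lborel) =
      (\<integral>\<^sup>+x. f (frac x) * indicator {c..<c + real l} x
          + f (frac x) * indicator {(c + real l)..<(c + real l)+1} x \<partial>lborel)"
      by (intro nn_integral_cong) (auto simp: indicator_def)
    also have "\<dots> = of_nat l * ?J + ?J"
      by (subst nn_integral_add) (simp_all add: Suc.IH nn_integral_frac_period del: of_nat_Suc)
    finally show ?case by (simp add: distrib_right add.commute)
  qed simp
  have "of_nat k * ?J = ennreal k * (\<integral>\<^sup>+x. f (frac (c + k * x)) * indicator {c..<c + real k} (c + k * x) \<partial>lborel)"
    unfolding periods[symmetric]
    by (subst nn_integral_real_affine[where c="real k" and t=c]) (use k in simp_all)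
  also have "\<dots> = of_nat k * ?L"
    using k by (intro arg_cong2[of _ _ _ _ "(*)"] nn_integral_cong)
      (auto simp: indicator_def ennreal_of_nat_eq_real_of_nat mult_less_cancel_left2 zero_le_mult_iff)
  finally show ?thesis
    using k by (simp add: ennreal_mult_cancel_left)
qed

section \<open>The powers of the skew product in closed form\<close>

text \<open>The power \<open>T^k\<close>: for k \<ge> 0 the second coordinate gains the sum of 2 (s
  + j \<alpha>) + \<alpha> over 0 \<le> j < k, which is 2 k s + k^2 \<alpha>. The same formula is
  right for negative \<open>k\<close>.\<close>

definition skew_iter :: "real \<Rightarrow> int \<Rightarrow> real \<times> real \<Rightarrow> real \<times> real" where
  "skew_iter \<alpha> k = (\<lambda>(s, t). (frac (s + k * \<alpha>), frac (t + 2 * k * s + k\<^sup>2 * \<alpha>)))"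

lemma space_torus2: "space torus2 = {0..<1} \<times> {0..<1}"
  by (simp add: torus2_def space_restrict_space)

lemma frac_eq_frac_iff: "frac x = frac y \<longleftrightarrow> x - y \<in> \<int>" for x y :: real
proof
  assume "frac x = frac y"
  then have "x - y = of_int (\<lfloor>x\<rfloor> - \<lfloor>y\<rfloor>)" by (simp add: frac_def)
  then show "x - y \<in> \<int>" by (metis Ints_of_int)
next
  assume "x - y \<in> \<int>"
  then obtain n where "x = y + of_int n" by (metis Ints_cases add.commute diff_add_cancel)
  then show "frac x = frac y" by simp
qed

text \<open>Reducing the inner point modulo 1 changes the outer coordinates by integers only,
  because the first coordinate enters the second one with the integer factor 2 j. The remaining
  terms agree by completing the square (j + k)^2.\<close>

lemma skew_iter_add: "skew_iter \<alpha> j (skew_iter \<alpha> k x) = skew_iter \<alpha> (j + k) x"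
proof -
  obtain s t where x: "x = (s, t)" by force
  have 1: "frac (s + k * \<alpha>) + j * \<alpha> - (s + (j + k) * \<alpha>) = of_int (- \<lfloor>s + k * \<alpha>\<rfloor>)"
    by (simp add: frac_def algebra_simps)
  have 2: "frac (t + 2 * of_int k * s + (of_int k)\<^sup>2 * \<alpha>) + 2 * of_int j * frac (s + of_int k * \<alpha>)
      + (of_int j)\<^sup>2 * \<alpha> - (t + 2 * of_int (j + k) * s + (of_int (j + k))\<^sup>2 * \<alpha>)
      = of_int (- \<lfloor>t + 2 * k * s + k\<^sup>2 * \<alpha>\<rfloor> - 2 * j * \<lfloor>s + k * \<alpha>\<rfloor>)"
    by (simp add: frac_def algebra_simps power2_eq_square)
  show ?thesis
    unfolding x skew_iter_def prod.case prod.inject frac_eq_frac_iff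
    by (simp only: 1 2 Ints_of_int)
qed

lemma skew_iter_0: "x \<in> space torus2 \<Longrightarrow> skew_iter \<alpha> 0 x = x"
  by (auto simp: skew_iter_def space_torus2 frac_eq)

lemma skew_iter_space: "skew_iter \<alpha> k x \<in> space torus2"
  by (auto simp: skew_iter_def space_torus2 frac_lt_1 split: prod.split)

lemma skew_iter_1: "skew_iter \<alpha> 1 = torus_skew \<alpha>"
  by (auto simp: skew_iter_def torus_skew_def add_ac)

text \<open>By the group law, \<open>skew_iter \<alpha> (-1)\<close> is a two-sided inverse on the
  fundamental domain, hence equal there to the \<open>inv_into\<close> that \<open>int_iter\<close>
  uses for negative times.\<close>

lemma int_iter_torus_skew:
  assumes x: "x \<in> space torus2"
  shows "int_iter (space torus2) (torus_skew \<alpha>) k x = skew_iter \<alpha> k x"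
proof -
  have inv: "inv_into (space torus2) (torus_skew \<alpha>) y = skew_iter \<alpha> (-1) y" if "y \<in> space torus2" for y
  proof (rule inv_into_f_eq)
    show "inj_on (torus_skew \<alpha>) (space torus2)"
    proof (rule inj_on_inverseI)
      show "skew_iter \<alpha> (-1) (torus_skew \<alpha> z) = z" if "z \<in> space torus2" for z
        using that by (simp add: skew_iter_1[symmetric] skew_iter_add skew_iter_0)
    qed
    show "torus_skew \<alpha> (skew_iter \<alpha> (-1) y) = y"
      using that by (simp add: skew_iter_1[symmetric] skew_iter_add skew_iter_0)
  qed (rule skew_iter_space)
  have pos: "(torus_skew \<alpha> ^^ n) x = skew_iter \<alpha> (int n) x" for n
    using x by (induction n) (simp_all add: skew_iter_0 skew_iter_1[symmetric] skew_iter_add)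
  have neg: "(inv_into (space torus2) (torus_skew \<alpha>) ^^ n) x = skew_iter \<alpha> (- int n) x" for n
    using x by (induction n) (simp_all add: skew_iter_0 inv skew_iter_space skew_iter_add)
  show ?thesis
    using pos[of "nat k"] neg[of "nat (- k)"] by (simp add: int_iter_def)
qed

section \<open>Haar measure on the torus and its invariance\<close>

lemma borel_Times:
  assumes "A \<in> sets borel" "B \<in> sets borel"
  shows "A \<times> B \<in> sets (borel :: ('a::second_countable_topology \<times> 'b::second_countable_topology) measure)"
  using pair_measureI[OF assms] by (simp only: borel_prod)

text \<open>Both orders of integration matter: invariance integrates over the second coordinate
  first, independence of the strips over the first.\<close>

lemma nn_integral_torus2:
  fixes f :: "real \<times> real \<Rightarrow> ennreal"
  assumes [measurable]: "f \<in> borel_measurable borel"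
  shows "(\<integral>\<^sup>+x. f x \<partial>torus2) =
    (\<integral>\<^sup>+s. (\<integral>\<^sup>+t. f (s, t) * indicator {0..<1} t \<partial>lborel) * indicator {0..<1} s \<partial>lborel)" (is ?A)
    and "(\<integral>\<^sup>+x. f x \<partial>torus2) =
    (\<integral>\<^sup>+t. (\<integral>\<^sup>+s. f (s, t) * indicator {0..<1} s \<partial>lborel) * indicator {0..<1} t \<partial>lborel)" (is ?B)
proof -
  have sets: "{0..<1::real} \<times> {0..<1::real} \<in> sets lborel"
    by (simp add: borel_Times)
  have meas: "(\<lambda>x. f x * indicator ({0..<1} \<times> {0..<1}) x) \<in> borel_measurable (lborel \<Otimes>\<^sub>M lborel)"
    unfolding lborel_prod using sets by measurable
  have "(\<integral>\<^sup>+x. f x \<partial>torus2) = (\<integral>\<^sup>+x. f x * indicator ({0..<1} \<times> {0..<1}) x \<partial>lborel)"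
    unfolding torus2_def by (rule nn_integral_restrict_space) (use sets in simp)
  also have "\<dots> = (\<integral>\<^sup>+x. f x * indicator ({0..<1} \<times> {0..<1}) x \<partial>(lborel \<Otimes>\<^sub>M lborel))"
    by (simp add: lborel_prod)
  finally have eq: "(\<integral>\<^sup>+x. f x \<partial>torus2) = \<dots>" .
  have "(\<integral>\<^sup>+t. f (s, t) * indicator ({0..<1} \<times> {0..<1}) (s, t) \<partial>lborel)
      = (\<integral>\<^sup>+t. f (s, t) * indicator {0..<1} t \<partial>lborel) * indicator {0..<1} s" for s
    by (cases "s \<in> {0..<1}") (simp_all add: indicator_times)
  then show ?A
    unfolding eq lborel.nn_integral_fst[OF meas, symmetric] by simp
  have "(\<integral>\<^sup>+s. f (s, t) * indicator ({0..<1} \<times> {0..<1}) (s, t) \<partial>lborel)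
      = (\<integral>\<^sup>+s. f (s, t) * indicator {0..<1} s \<partial>lborel) * indicator {0..<1} t" for t
    by (cases "t \<in> {0..<1}") (simp_all add: indicator_times)
  then show ?B
    unfolding eq lborel_pair.nn_integral_snd[OF meas, symmetric] by simp
qed

lemma skew_iter_borel [measurable]: "skew_iter \<alpha> k \<in> borel_measurable borel"
  unfolding skew_iter_def case_prod_beta'
  by (intro borel_measurable_Pair measurable_compose[OF _ borel_measurable_frac]
      borel_measurable_continuous_onI continuous_intros)

lemma skew_iter_measurable [measurable]: "skew_iter \<alpha> k \<in> torus2 \<rightarrow>\<^sub>M torus2"
proof -
  have "skew_iter \<alpha> k \<in> torus2 \<rightarrow>\<^sub>M lborel"
    unfolding torus2_def by (rule measurable_restrict_space1) simp
  moreover have "skew_iter \<alpha> k \<in> space torus2 \<rightarrow> {0..<1} \<times> {0..<1}"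
    using skew_iter_space by (auto simp only: space_torus2)
  ultimately show ?thesis
    by (subst (2) torus2_def) (rule measurable_restrict_space2)
qed

text \<open>For fixed \<open>s\<close> the second coordinate is rotated by an angle depending on
  \<open>s\<close> only, so the inner integral is that of the fibre over the rotated point. The
  first coordinate then undergoes a rotation too.\<close>

lemma nn_integral_skew_iter:
  fixes f :: "real \<times> real \<Rightarrow> ennreal"
  assumes [measurable]: "f \<in> borel_measurable borel"
  shows "(\<integral>\<^sup>+x. f (skew_iter \<alpha> k x) \<partial>torus2) = (\<integral>\<^sup>+x. f x \<partial>torus2)"
proof -
  define \<Psi> where "\<Psi> s = (\<integral>\<^sup>+t. f (s, t) * indicator {0..<1} t \<partial>lborel)" for s
  have f2: "f \<in> borel_measurable (borel \<Otimes>\<^sub>M borel)" by (simp add: borel_prod)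
  have [measurable]: "\<Psi> \<in> borel_measurable borel"
    unfolding \<Psi>_def using f2 by measurable
  have [measurable]: "(\<lambda>t. f (s, t)) \<in> borel_measurable borel" for s
    using f2 by measurable
  \<comment> \<open>The factor \<open>real 1\<close> presents the rotation as the case k = 1 of
    \<open>nn_integral_frac_affine\<close>.\<close>
  have "(\<integral>\<^sup>+x. f (skew_iter \<alpha> k x) \<partial>torus2) =
      (\<integral>\<^sup>+s. (\<integral>\<^sup>+t. f (frac (s + k * \<alpha>), frac ((2 * k * s + k\<^sup>2 * \<alpha>) + real 1 * t)) * indicator {0..<1} t \<partial>lborel)
        * indicator {0..<1} s \<partial>lborel)"
    using nn_integral_torus2(1)[OF measurable_compose[OF skew_iter_borel[of \<alpha> k] assms]]
    by (simp add: skew_iter_def add_ac)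
  also have "\<dots> = (\<integral>\<^sup>+s. \<Psi> (frac (k * \<alpha> + real 1 * s)) * indicator {0..<1} s \<partial>lborel)"
    unfolding \<Psi>_def
    by (subst nn_integral_frac_affine) (simp_all add: add_ac)
  also have "\<dots> = (\<integral>\<^sup>+s. \<Psi> s * indicator {0..<1} s \<partial>lborel)"
    by (subst nn_integral_frac_affine) simp_all
  finally show ?thesis
    unfolding nn_integral_torus2(1)[OF assms] \<Psi>_def .
qed

section \<open>Strips and their independence\<close>

text \<open>The cut is made in the second coordinate, into which nonzero powers of the map mix a
  multiple of \<open>s\<close>. The first coordinate is merely rotated and would give no
  independence.\<close>

definition strip :: "nat \<Rightarrow> nat \<Rightarrow> (real \<times> real) set" where
  "strip q i = {0..<1} \<times> {(real i - 1) / q..<real i / q}"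

lemma strip_subset: "i \<in> {1..q} \<Longrightarrow> strip q i \<subseteq> space torus2"
proof -
  assume "i \<in> {1..q}"
  then have "0 \<le> (real i - 1) / q" "real i / q \<le> 1" by (auto simp: field_simps)
  then show ?thesis
    unfolding strip_def space_torus2 by (intro Sigma_mono) (auto intro: order_trans less_le_trans)
qed

lemma sets_torus2_iff: "B \<in> sets torus2 \<longleftrightarrow> B \<subseteq> space torus2 \<and> B \<in> sets borel"
  unfolding space_torus2 unfolding torus2_def
  by (subst sets_restrict_space_iff) (auto simp: borel_Times)

lemma strip_sets: "i \<in> {1..q} \<Longrightarrow> strip q i \<in> sets torus2"
  using strip_subset[of i q] unfolding sets_torus2_iff by (auto simp: strip_def intro: borel_Times)

lemma strip_partition:
  assumes x: "x \<in> space torus2" and "0 < q"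
  shows "(\<Sum>i=1..q. indicator (strip q i) x) = (1::real)"
proof -
  obtain s t where st: "x = (s, t)" "0 \<le> s" "s < 1" "0 \<le> t" "t < 1"
    using x by (auto simp: space_torus2)
  \<comment> \<open>The summand 1 is there because the strips are numbered from 1.\<close>
  define i0 where "i0 = nat (\<lfloor>q * t\<rfloor> + 1)"
  have fl: "0 \<le> \<lfloor>q * t\<rfloor>" "\<lfloor>q * t\<rfloor> < q"
    using st \<open>0 < q\<close> by (simp_all add: floor_less_iff)
  have i0: "i0 \<in> {1..q}" using fl unfolding i0_def atLeastAtMost_iff by linarith
  have mem: "x \<in> strip q i \<longleftrightarrow> i = i0" for i
  proof -
    have "x \<in> strip q i \<longleftrightarrow> real i - 1 \<le> q * t \<and> q * t < real i"
      using st \<open>0 < q\<close> by (auto simp: strip_def field_simps)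
    also have "\<dots> \<longleftrightarrow> \<lfloor>q * t\<rfloor> = int i - 1"
      by (auto simp: floor_eq_iff)
    also have "\<dots> \<longleftrightarrow> i = i0" using fl by (auto simp: i0_def)
    finally show ?thesis .
  qed
  have "(\<Sum>i=1..q. indicator (strip q i) x) = (\<Sum>i=1..q. if i = i0 then 1 else (0::real))"
    by (intro sum.cong) (auto simp: indicator_def mem)
  then show ?thesis using i0 by simp
qed

lemma nn_integral_strip:
  fixes i q :: nat
  assumes "i \<in> {1..q}"
  shows "(\<integral>\<^sup>+t. indicator {(real i - 1) / q..<real i / q} t * indicator {0..<1} t \<partial>lborel) = ennreal (1 / q)"
proof -
  have b: "0 \<le> (real i - 1) / q" "real i / q \<le> 1" using assms by (auto simp: field_simps)
  have "(\<integral>\<^sup>+t. indicator {(real i - 1) / q..<real i / q} t * indicator {0..<1} t \<partial>lborel)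
      = (\<integral>\<^sup>+t. indicator {(real i - 1) / q..<real i / q} t \<partial>lborel)"
    using b by (intro nn_integral_cong) (auto simp: indicator_def)
  also have "\<dots> = emeasure lborel {(real i - 1) / q..<real i / q}"
    by simp
  also have "\<dots> = ennreal (real i / q - (real i - 1) / q)"
    by (rule emeasure_lborel_Ico) (simp add: divide_right_mono)
  also have "real i / q - (real i - 1) / q = 1 / q"
    by (simp add: diff_divide_distrib)
  finally show ?thesis .
qed

lemma indicator_strip:
  "s \<in> {0..<1} \<Longrightarrow> indicator (strip q i) (s, t) = indicator {(real i - 1) / q..<real i / q} t"
  by (simp add: strip_def indicator_def)

lemma emeasure_strip:
  assumes i: "i \<in> {1..q}"
  shows "emeasure torus2 (strip q i) = ennreal (1 / q)"
proof -
  have B: "strip q i \<in> sets borel" using strip_sets[OF i] by (simp add: sets_torus2_iff)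
  have "emeasure torus2 (strip q i) = (\<integral>\<^sup>+x. indicator (strip q i) x \<partial>torus2)"
    using strip_sets[OF i] by simp
  also have "\<dots> = (\<integral>\<^sup>+(s::real). (\<integral>\<^sup>+t. indicator {(real i - 1) / q..<real i / q} t * indicator {0..<1} t \<partial>lborel)
      * indicator {0..<1} s \<partial>lborel)"
  proof -
    have "(\<integral>\<^sup>+t. indicator (strip q i) (s, t) * indicator {0..<1} t \<partial>lborel) * indicator {0..<1} s
      = (\<integral>\<^sup>+t. indicator {(real i - 1) / q..<real i / q} t * indicator {0..<1} t \<partial>lborel)
        * indicator {0..<1} s" for s :: real
      by (cases "s \<in> {0..<1}") (simp_all add: indicator_strip)
    then show ?thesis
      by (simp only: nn_integral_torus2(1)[OF borel_measurable_indicator[OF B]])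
  qed
  also have "\<dots> = ennreal (1 / q)"
    by (simp add: nn_integral_strip[OF i] nn_integral_cmult)
  finally show ?thesis .
qed

text \<open>Integrating first over the first coordinate, the point \<open>frac (t + 2 k s + k\<^sup>2 \<alpha>)\<close> is
  uniformly distributed for every fixed \<open>t\<close>, because \<open>2 k\<close> is a nonzero integer.\<close>

lemma emeasure_strip_skew_iter:
  assumes i: "i \<in> {1..q}" and j: "j \<in> {1..q}" and k: "0 < k"
  shows "emeasure torus2 {x \<in> space torus2. skew_iter \<alpha> k x \<in> strip q i \<and> x \<in> strip q j}
    = ennreal (1 / (real q)\<^sup>2)"
proof -
  note [measurable] = strip_sets[OF i] strip_sets[OF j]
  have B: "strip q i \<in> sets borel" "strip q j \<in> sets borel"
    using strip_sets[OF i] strip_sets[OF j] by (simp_all add: sets_torus2_iff)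
  define u where "u i = (indicator {(real i - 1) / q..<real i / q} :: real \<Rightarrow> ennreal)" for i
  have [measurable]: "u i \<in> borel_measurable borel" for i by (simp add: u_def)
  \<comment> \<open>The integer slope of the second coordinate in \<open>s\<close>, as the natural
    number that \<open>nn_integral_frac_affine\<close> expects.\<close>
  define l where "l = nat (2 * k)"
  have l: "0 < l" "2 * real_of_int k = real l" using k by (simp_all add: l_def)
  have "emeasure torus2 {x \<in> space torus2. skew_iter \<alpha> k x \<in> strip q i \<and> x \<in> strip q j}
      = (\<integral>\<^sup>+x. indicator {x \<in> space torus2. skew_iter \<alpha> k x \<in> strip q i \<and> x \<in> strip q j} x \<partial>torus2)"
    by simp
  also have "\<dots> = (\<integral>\<^sup>+x. indicator (strip q i) (skew_iter \<alpha> k x) * indicator (strip q j) x \<partial>torus2)"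
    by (intro nn_integral_cong) (auto simp: indicator_def)
  also have "\<dots> = (\<integral>\<^sup>+t. (\<integral>\<^sup>+s. indicator (strip q i) (skew_iter \<alpha> k (s, t)) * indicator (strip q j) (s, t)
      * indicator {0..<1} s \<partial>lborel) * indicator {0..<1} t \<partial>lborel)"
    using B measurable_compose[OF skew_iter_borel borel_measurable_indicator[OF B(1)], of \<alpha> k]
    by (intro nn_integral_torus2(2) borel_measurable_times) auto
  also have "\<dots> = (\<integral>\<^sup>+t. (\<integral>\<^sup>+s. u j t * (u i (frac ((t + k\<^sup>2 * \<alpha>) + l * s)) * indicator {0..<1} s) \<partial>lborel)
      * indicator {0..<1} t \<partial>lborel)"
  proof -
    have "indicator (strip q i) (skew_iter \<alpha> k (s, t)) * indicator (strip q j) (s, t) * indicator {0..<1} s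
        = u j t * (u i (frac ((t + k\<^sup>2 * \<alpha>) + l * s)) * indicator {0..<1} s)" for s t :: real
      unfolding skew_iter_def l(2)[symmetric] u_def
      by (cases "s \<in> {0..<1}") (simp_all add: indicator_strip frac_lt_1 add_ac mult_ac)
    then show ?thesis by simp
  qed
  also have "\<dots> = (\<integral>\<^sup>+t. ennreal (1 / q) * (u j t * indicator {0..<1} t) \<partial>lborel)"
  proof -
    have "(\<integral>\<^sup>+s. u j t * (u i (frac ((t + k\<^sup>2 * \<alpha>) + l * s)) * indicator {0..<1} s) \<partial>lborel)
        = u j t * ennreal (1 / q)" for t
      using l(1) nn_integral_strip[OF i, folded u_def]
      by (subst nn_integral_cmult) (simp_all add: nn_integral_frac_affine)
    then show ?thesis by (simp add: mult_ac)
  qed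
  also have "\<dots> = ennreal (1 / q) * ennreal (1 / q)"
    using nn_integral_strip[OF j, folded u_def] by (simp add: nn_integral_cmult)
  also have "\<dots> = ennreal (1 / (real q)\<^sup>2)"
    by (simp add: ennreal_mult[symmetric] power2_eq_square)
  finally show ?thesis .
qed

section \<open>The torus as an instance of the abstract setting\<close>

lemma prob_space_torus2: "prob_space torus2"
proof
  \<comment> \<open>The partition into a single strip yields the total mass.\<close>
  have "strip 1 1 = space torus2" by (simp add: strip_def space_torus2)
  then show "emeasure torus2 (space torus2) = 1"
    using emeasure_strip[of 1 1] by simp
qed

lemma distr_skew_iter: "distr torus2 torus2 (skew_iter \<alpha> k) = torus2"
proof (rule measure_eqI)
  fix B assume "B \<in> sets (distr torus2 torus2 (skew_iter \<alpha> k))"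
  then have B: "B \<in> sets torus2" "B \<in> sets borel" by (simp_all add: sets_torus2_iff)
  note [measurable] = B(1)
  have "emeasure (distr torus2 torus2 (skew_iter \<alpha> k)) B = (\<integral>\<^sup>+x. indicator B x \<partial>distr torus2 torus2 (skew_iter \<alpha> k))"
    by simp
  also have "\<dots> = (\<integral>\<^sup>+x. indicator B (skew_iter \<alpha> k x) \<partial>torus2)"
    by (rule nn_integral_distr) measurable
  also have "\<dots> = (\<integral>\<^sup>+x. indicator B x \<partial>torus2)"
    using B(2) by (intro nn_integral_skew_iter) simp
  also have "\<dots> = emeasure torus2 B" by simp
  finally show "emeasure (distr torus2 torus2 (skew_iter \<alpha> k)) B = emeasure torus2 B" .
qed simp

theorem proposition3p4:
  fixes \<alpha> :: real
  assumes "\<alpha> \<notin> \<rat>"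
  shows "\<forall>n::nat. n \<ge> 1 \<longrightarrow> \<not> AT torus2 (torus_skew \<alpha>) n"
proof (intro allI impI)
  fix n :: nat
  assume n: "n \<ge> 1"
  \<comment> \<open>The smallest \<open>Q\<close> allowed by \<open>not_AT\<close> is 16 n, and
    \<open>q\<close> is its square.\<close>
  define q where "q = (16 * n)\<^sup>2"
  have q: "0 < q" using n by (simp add: q_def)
  interpret torus: prob_space torus2 by (rule prob_space_torus2)
  interpret uniform_independent_partition torus2 "skew_iter \<alpha>" "16 * n" q "strip q"
  proof unfold_locales
    show "q = (16 * n)\<^sup>2" by (rule q_def)
    fix i assume i: "i \<in> {1..q}"
    show "torus.prob (strip q i) = 1 / real q"
      using emeasure_strip[OF i] by (simp add: measure_def)
    fix j and k :: int assume "j \<in> {1..q}" "0 < k"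
    then show "torus.prob {x \<in> space torus2. skew_iter \<alpha> k x \<in> strip q i \<and> x \<in> strip q j}
        = 1 / (real q)\<^sup>2"
      using emeasure_strip_skew_iter[OF i, of j k \<alpha>] by (simp add: measure_def)
  qed (use n q in \<open>simp_all add: skew_iter_measurable distr_skew_iter skew_iter_add skew_iter_0
      strip_sets strip_partition del: atLeastAtMost_iff One_nat_def\<close>)
  show "\<not> AT torus2 (torus_skew \<alpha>) n"
    using n by (intro not_AT int_iter_torus_skew) simp_all
qed

end
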